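(* Let $(A,\mathcal R)$ be an abstract argumentation framework with $A$ finite, $\kappa$ the associated argumentative context, $\varsigma$ a sequence, $\chi=(\varsigma,\kappa)$, and let $S^\chi(t)$ be a state of the path valid with respect to $\chi$. Suppose $S^\chi(t)$ is a $\Sigma_c$-argumentative state and let $\mathcal L_t$ be its associated labelling. Then $\mathcal L_t$ is a complete labelling of the argumentation framework $(Ar,\mathcal R_t)$, where $Ar=\{x\in A: S^\chi(t)\models p_x\}$ and $\mathcal R_t=\{(y,x): S^\chi(t)\models p_x\wedge p_y\wedge cA_{y,x}\}$.
   Context: **Fluents and states.** $(A,\mathcal R)$ is an abstract argumentation framework: $A$ is a finite set of arguments and $\mathcal R\subseteq A\times A$ is the attack relation. The set $\mathbb F$ of fluents consists of $p_x$ ($x$ is present), $i_x$ ($x$ is in), $o_x$ ($x$ is out) for $x\in A$, and $cA_{y,x}$ ($y$ can attack $x$) for $x,y\in A$. $Lit_{\mathbb F}=\mathbb F\cup\{\neg f: f\in\mathbb F\}$, and $\overline{l}$ denotes the complement of a literal $l$. A state is a set of literals containing exactly one of $f,\neg f$ for every $f\in\mathbb F$ (a truth assignment); $S\models\psi$ is propositional satisfaction. **Events.** $\mathbb E=\mathbb A\cup\mathbb U$ (disjoint). Actions: $\mathbb A=\{enunciate_x: x\in A\}$ with $pre(enunciate_x)=\top$ and $\mathrm{eff}(enunciate_x)=\{p_x,i_x,\neg o_x\}$. Exogenous events: $\mathbb U=\{\Delta^1_{y,x},\Delta^2_{y,x},I^1_x,I^2_x : x,y\in A\}$, for which $pre=tri$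 and - $tri(\Delta^1_{y,x})= p_x\wedge i_x\wedge p_y\wedge cA_{y,x}\wedge\neg o_y$, $\mathrm{eff}(\Delta^1_{y,x})=\{\neg i_x\}$; - $tri(\Delta^2_{y,x})= p_x\wedge\neg o_x\wedge p_y\wedge cA_{y,x}\wedge i_y$, $\mathrm{eff}(\Delta^2_{y,x})=\{o_x\}$; - $tri(I^1_x)= p_x\wedge o_x\wedge\bigwedge_{y\in A}\big((cA_{y,x}\wedge\neg i_y)\vee\neg cA_{y,x}\big)$, $\mathrm{eff}(I^1_x)=\{\neg o_x\}$; - $tri(I^2_x)= p_x\wedge\neg i_x\wedge\bigwedge_{y\in A}\big((cA_{y,x}\wedge o_y)\vee\neg cA_{y,x}\big)$, $\mathrm{eff}(I^2_x)=\{i_x\}$. **Priorities.** The strict partial order $\succ$ on $\mathbb E$ consists exactly of: $I^1_x\succ I^2_x$ for all $x$; $I^1_{x_1}\succ\Delta^2_{y_2,x_2}$ and $\Delta^1_{y_1,x_1}\succ\Delta^2_{y_2,x_2}$ for all $x_1,y_1,x_2,y_2\in A$. **Initial state.** In $S_0$: for all $x$, $\neg p_x,\neg i_x,o_x$ hold; $cA_{y,x}$ holds iff $(y,x)\in\mathcal R$. The argumentative context $\kappa$ consists of all the data above together with a time domain $\mathbb T=\{0,\dots,N\}$. **Valid paths.** A path $S(0),E(0),S(1),\dots,E(N),S(N+1)$ is valid with respect to $\kappa$ if $S(0)=S_0$ and for each $t\in\mathbb T$: (1) $S(t)$ is a state; (2.a) $S(t)\models pre(e)$ for all $e\in E(t)\subseteq\mathbb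 E$; (2.b) there are no $e,e'\in E(t)$ with $e\succ e'$; (2.c) for each $e\in\mathbb U$ with $S(t)\models tri(e)$, either $e\in E(t)$ or some $e'\in E(t)$ has $e'\succ e$; (2.d) if $E(t)\cap\mathbb A\neq\emptyset$ then $S(t)\not\models tri(e')$ for all $e'\in\mathbb U$; (2.e) $E(t)\ne\emptyset$; (3) $S(t+1)=\{l\in S(t):\forall e\in E(t),\ \overline{l}\notin \mathrm{eff}(e)\}\cup\{l\in Lit_{\mathbb F}:\exists e\in E(t),\ l\in\mathrm{eff}(e)\}$. **Sequences.** A sequence is a set $\varsigma\subseteq\mathbb A\times\mathbb N$ of ranked actions. A valid path w.r.t. $\kappa$ is valid w.r.t. $\chi=(\varsigma,\kappa)$ if: (1) every action occurring in some $E(t)$ is the first component of an element of $\varsigma$; (2) for $(e,o),(e',o')\in\varsigma$ with $o<o'$ there are $t<t'$ with $e\in E(t)$, $e'\in E(t')$; (3) for $(e,o),(e',o')\in\varsigma$ with $o=o'$ there is $t$ with $e,e'\in E(t)$. $S^\chi(t),E^\chi(t)$ denote the states and event sets of such a path. **$\Sigma_c$-argumentative state.** A state $S$ is $\Sigma_c$-argumentative if for every $x\in A$: (i) $S\models p_x\wedge i_x\wedge\neg o_x$ iff $S\models p_x\wedge\bigwedge_{y\in A}\big((cA_{y,x}\wedge\neg i_y\wedge o_y)\vee\neg cA_{y,x}\big)$; and (ii) $S\models p_x\wedge\neg i_x\wedge o_x$ iff there is $y\in A$ with $S\models p_x\wedge p_y\wedge cA_{y,x}\wedge i_y\wedge\neg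 o_y$. **Associated labelling.** For a state $S^\chi(t)$, $\mathcal L_t$ is the labelling on $Ar=\{x\in A: S^\chi(t)\models p_x\}$ giving $x$ the label IN if $S^\chi(t)\models i_x\wedge\neg o_x$, OUT if $S^\chi(t)\models\neg i_x\wedge o_x$, UNDEC if $S^\chi(t)\models\neg i_x\wedge\neg o_x$. (The combination $i_x\wedge o_x$ never occurs in states of a valid path.) **Complete labelling.** A labelling $\mathcal L: Ar\to\{\mathrm{IN},\mathrm{OUT},\mathrm{UNDEC}\}$ of $(Ar,\mathcal R')$ is complete iff for every $x\in Ar$: $\mathcal L(x)=\mathrm{IN}$ iff every $y$ with $(y,x)\in\mathcal R'$ has $\mathcal L(y)=\mathrm{OUT}$; and $\mathcal L(x)=\mathrm{OUT}$ iff some $y$ with $(y,x)\in\mathcal R'$ has $\mathcal L(y)=\mathrm{IN}$. *)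

theory Defs
  imports Main
begin

section \<open>Argumentation frameworks and complete labellings\<close>

definition arg_framework :: "'a set \<Rightarrow> ('a \<times> 'a) set \<Rightarrow> bool" where
  "arg_framework A R \<longleftrightarrow> finite A \<and> R \<subseteq> A \<times> A"

datatype label = IN | OUT | UNDEC

text \<open>A labelling \<open>Ar \<rightarrow> {IN, OUT, UNDEC}\<close> is a partial map whose domain is exactly \<open>Ar\<close>.\<close>

definition labelling :: "'a set \<Rightarrow> ('a \<rightharpoonup> label) \<Rightarrow> bool" where
  "labelling Ar L \<longleftrightarrow> dom L = Ar"

definition complete_labelling :: "'a set \<Rightarrow> ('a \<times> 'a) set \<Rightarrow> ('a \<rightharpoonup> label) \<Rightarrow> bool" where
  "complete_labelling Ar R L \<longleftrightarrow>
     labelling Ar L \<and>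
     (\<forall>x\<in>Ar. (L x = Some IN \<longleftrightarrow> (\<forall>y. (y, x) \<in> R \<longrightarrow> L y = Some OUT)) \<and>
              (L x = Some OUT \<longleftrightarrow> (\<exists>y. (y, x) \<in> R \<and> L y = Some IN)))"

section \<open>Fluents, literals, states and formulas\<close>

text \<open>\<open>Can_Attack y x\<close> reads ``\<open>y\<close> can attack \<open>x\<close>''.\<close>

datatype 'a fluent = Present 'a | In 'a | Out 'a | Can_Attack 'a 'a

datatype 'a literal = Pos "'a fluent" | Neg "'a fluent"

primrec compl :: "'a literal \<Rightarrow> 'a literal" where
  "compl (Pos f) = Neg f"
| "compl (Neg f) = Pos f"

definition fluents :: "'a set \<Rightarrow> 'a fluent set" where
  "fluents A = Present ` A \<union> In ` A \<union> Out ` A \<union> {Can_Attack y x | x y. x \<in> A \<and> y \<in> A}"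

definition literals :: "'a fluent set \<Rightarrow> 'a literal set" where
  "literals F = Pos ` F \<union> Neg ` F"

definition is_state :: "'a fluent set \<Rightarrow> 'a literal set \<Rightarrow> bool" where
  "is_state F S \<longleftrightarrow> S \<subseteq> literals F \<and> (\<forall>f\<in>F. (Pos f \<in> S) \<noteq> (Neg f \<in> S))"

datatype 'a form =
    Top
  | Atom "'a fluent"
  | Negation "'a form"  ("\<^bold>\<not> _" [40] 40)
  | Conj "'a form" "'a form"  (infixr "\<^bold>\<and>" 35)
  | Disj "'a form" "'a form"  (infixr "\<^bold>\<or>" 30)
  | BigConj "'a set" "'a \<Rightarrow> 'a form"

primrec sat :: "'a literal set \<Rightarrow> 'a form \<Rightarrow> bool"  (infix "\<Turnstile>" 25) where
  "(S \<Turnstile> Top) \<longleftrightarrow> True"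
| "(S \<Turnstile> Atom f) \<longleftrightarrow> Pos f \<in> S"
| "(S \<Turnstile> \<^bold>\<not> \<phi>) \<longleftrightarrow> \<not> (S \<Turnstile> \<phi>)"
| "(S \<Turnstile> \<phi> \<^bold>\<and> \<psi>) \<longleftrightarrow> (S \<Turnstile> \<phi>) \<and> (S \<Turnstile> \<psi>)"
| "(S \<Turnstile> \<phi> \<^bold>\<or> \<psi>) \<longleftrightarrow> (S \<Turnstile> \<phi>) \<or> (S \<Turnstile> \<psi>)"
| "(S \<Turnstile> BigConj B \<phi>) \<longleftrightarrow> (\<forall>y\<in>B. S \<Turnstile> \<phi> y)"

abbreviation present :: "'a \<Rightarrow> 'a form" where "present x \<equiv> Atom (Present x)"
abbreviation is_in :: "'a \<Rightarrow> 'a form" where "is_in x \<equiv> Atom (In x)"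
abbreviation is_out :: "'a \<Rightarrow> 'a form" where "is_out x \<equiv> Atom (Out x)"
abbreviation cA :: "'a \<Rightarrow> 'a \<Rightarrow> 'a form" where "cA y x \<equiv> Atom (Can_Attack y x)"

section \<open>Events\<close>

text \<open>In \<open>Delta1 y x\<close> and \<open>Delta2 y x\<close>, \<open>y\<close> is the attacker and \<open>x\<close> the attacked argument whose
  status changes.\<close>

datatype 'a event =
    Enunciate 'a
  | Delta1 'a 'a
  | Delta2 'a 'a
  | I1 'a
  | I2 'a

definition arg_actions :: "'a set \<Rightarrow> 'a event set" where
  "arg_actions A = Enunciate ` A"

definition arg_exogenous :: "'a set \<Rightarrow> 'a event set" where
  "arg_exogenous A = {Delta1 y x | x y. x \<in> A \<and> y \<in> A} \<union> {Delta2 y x | x y. x \<in> A \<and> y \<in> A}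
     \<union> I1 ` A \<union> I2 ` A"

text \<open>Only exogenous events have a trigger; the value on actions is a dummy that is never
  consulted, since triggers are only evaluated on the set of exogenous events.\<close>

primrec arg_tri :: "'a set \<Rightarrow> 'a event \<Rightarrow> 'a form" where
  "arg_tri A (Enunciate x) = (\<^bold>\<not> Top)"
| "arg_tri A (Delta1 y x) = (present x \<^bold>\<and> is_in x \<^bold>\<and> present y \<^bold>\<and> cA y x \<^bold>\<and> (\<^bold>\<not> is_out y))"
| "arg_tri A (Delta2 y x) = (present x \<^bold>\<and> (\<^bold>\<not> is_out x) \<^bold>\<and> present y \<^bold>\<and> cA y x \<^bold>\<and> is_in y)"
| "arg_tri A (I1 x) =
     (present x \<^bold>\<and> is_out x \<^bold>\<and> BigConj A (\<lambda>y. (cA y x \<^bold>\<and> (\<^bold>\<not> is_in y)) \<^bold>\<or> (\<^bold>\<not> cA y x)))"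
| "arg_tri A (I2 x) =
     (present x \<^bold>\<and> (\<^bold>\<not> is_in x) \<^bold>\<and> BigConj A (\<lambda>y. (cA y x \<^bold>\<and> is_out y) \<^bold>\<or> (\<^bold>\<not> cA y x)))"

definition arg_pre :: "'a set \<Rightarrow> 'a event \<Rightarrow> 'a form" where
  "arg_pre A e = (case e of Enunciate x \<Rightarrow> Top | _ \<Rightarrow> arg_tri A e)"

primrec arg_eff :: "'a event \<Rightarrow> 'a literal set" where
  "arg_eff (Enunciate x) = {Pos (Present x), Pos (In x), Neg (Out x)}"
| "arg_eff (Delta1 y x) = {Neg (In x)}"
| "arg_eff (Delta2 y x) = {Pos (Out x)}"
| "arg_eff (I1 x) = {Neg (Out x)}"
| "arg_eff (I2 x) = {Pos (In x)}"

text \<open>A pair \<open>(e, e')\<close> means \<open>e \<succ> e'\<close>: \<open>e\<close> has priority over \<open>e'\<close>.\<close>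

definition arg_priority :: "'a set \<Rightarrow> ('a event \<times> 'a event) set" where
  "arg_priority A =
     {(I1 x, I2 x) | x. x \<in> A}
     \<union> {(I1 x1, Delta2 y2 x2) | x1 x2 y2. x1 \<in> A \<and> x2 \<in> A \<and> y2 \<in> A}
     \<union> {(Delta1 y1 x1, Delta2 y2 x2) | x1 y1 x2 y2. x1 \<in> A \<and> y1 \<in> A \<and> x2 \<in> A \<and> y2 \<in> A}"

definition arg_init :: "'a set \<Rightarrow> ('a \<times> 'a) set \<Rightarrow> 'a literal set" where
  "arg_init A R =
     {Neg (Present x) | x. x \<in> A} \<union> {Neg (In x) | x. x \<in> A} \<union> {Pos (Out x) | x. x \<in> A}
     \<union> {Pos (Can_Attack y x) | x y. x \<in> A \<and> y \<in> A \<and> (y, x) \<in> R}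
     \<union> {Neg (Can_Attack y x) | x y. x \<in> A \<and> y \<in> A \<and> (y, x) \<notin> R}"

section \<open>Contexts and valid paths\<close>

record 'a ctxt =
  Fluents :: "'a fluent set"
  Actions :: "'a event set"
  Exogenous :: "'a event set"
  Pre :: "'a event \<Rightarrow> 'a form"
  Tri :: "'a event \<Rightarrow> 'a form"
  Eff :: "'a event \<Rightarrow> 'a literal set"
  Priority :: "('a event \<times> 'a event) set"
  Init :: "'a literal set"
  Times :: "nat set"

definition arg_context :: "'a set \<Rightarrow> ('a \<times> 'a) set \<Rightarrow> nat \<Rightarrow> 'a ctxt" where
  "arg_context A R N =
     \<lparr> Fluents = fluents A,
       Actions = arg_actions A,
       Exogenous = arg_exogenous A,
       Pre = arg_pre A,
       Tri = arg_tri A,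
       Eff = arg_eff,
       Priority = arg_priority A,
       Init = arg_init A R,
       Times = {0..N} \<rparr>"

definition successor ::
    "'a ctxt \<Rightarrow> 'a literal set \<Rightarrow> 'a event set \<Rightarrow> 'a literal set" where
  "successor \<kappa> S E =
     {l \<in> S. \<forall>e\<in>E. compl l \<notin> Eff \<kappa> e}
     \<union> {l \<in> literals (Fluents \<kappa>). \<exists>e\<in>E. l \<in> Eff \<kappa> e}"

text \<open>A path \<open>S(0), E(0), S(1), \<dots>, E(N), S(N+1)\<close> is given by two functions on \<open>nat\<close>; their
  values at \<open>t > N + 1\<close> and \<open>t > N\<close>, respectively, are irrelevant.\<close>

definition valid_path ::
    "'a ctxt \<Rightarrow> (nat \<Rightarrow> 'a literal set) \<Rightarrow> (nat \<Rightarrow> 'a event set) \<Rightarrow> bool" where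
  "valid_path \<kappa> S E \<longleftrightarrow>
     S 0 = Init \<kappa> \<and>
     (\<forall>t \<in> Times \<kappa>.
        is_state (Fluents \<kappa>) (S t) \<and>
        E t \<subseteq> Actions \<kappa> \<union> Exogenous \<kappa> \<and>
        (\<forall>e \<in> E t. S t \<Turnstile> Pre \<kappa> e) \<and>
        \<not> (\<exists>e \<in> E t. \<exists>e' \<in> E t. (e, e') \<in> Priority \<kappa>) \<and>
        (\<forall>e \<in> Exogenous \<kappa>. (S t \<Turnstile> Tri \<kappa> e) \<longrightarrow>
           e \<in> E t \<or> (\<exists>e' \<in> E t. (e', e) \<in> Priority \<kappa>)) \<and>
        (E t \<inter> Actions \<kappa> \<noteq> {} \<longrightarrow> (\<forall>e' \<in> Exogenous \<kappa>. \<not> (S t \<Turnstile> Tri \<kappa> e'))) \<and>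
        E t \<noteq> {} \<and>
        S (Suc t) = successor \<kappa> (S t) (E t))"

definition is_sequence :: "'a ctxt \<Rightarrow> ('a event \<times> nat) set \<Rightarrow> bool" where
  "is_sequence \<kappa> \<sigma> \<longleftrightarrow> \<sigma> \<subseteq> Actions \<kappa> \<times> UNIV"

definition seq_valid_path ::
    "('a event \<times> nat) set \<times> 'a ctxt \<Rightarrow> (nat \<Rightarrow> 'a literal set) \<Rightarrow> (nat \<Rightarrow> 'a event set) \<Rightarrow> bool" where
  "seq_valid_path \<chi> S E \<longleftrightarrow> (case \<chi> of (\<sigma>, \<kappa>) \<Rightarrow>
     valid_path \<kappa> S E \<and>
     (\<forall>t \<in> Times \<kappa>. \<forall>e \<in> E t \<inter> Actions \<kappa>. e \<in> fst ` \<sigma>) \<and>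
     (\<forall>(e, k) \<in> \<sigma>. \<forall>(e', k') \<in> \<sigma>. k < k' \<longrightarrow>
        (\<exists>t \<in> Times \<kappa>. \<exists>t' \<in> Times \<kappa>. t < t' \<and> e \<in> E t \<and> e' \<in> E t')) \<and>
     (\<forall>(e, k) \<in> \<sigma>. \<forall>(e', k') \<in> \<sigma>. k = k' \<longrightarrow>
        (\<exists>t \<in> Times \<kappa>. e \<in> E t \<and> e' \<in> E t)))"

section \<open>Argumentative states and their labellings\<close>

definition sigma_c_argumentative :: "'a set \<Rightarrow> 'a literal set \<Rightarrow> bool" where
  "sigma_c_argumentative A S \<longleftrightarrow> (\<forall>x\<in>A.
     ((S \<Turnstile> present x \<^bold>\<and> is_in x \<^bold>\<and> (\<^bold>\<not> is_out x)) \<longleftrightarrow>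
      (S \<Turnstile> present x \<^bold>\<and> BigConj A (\<lambda>y. (cA y x \<^bold>\<and> (\<^bold>\<not> is_in y) \<^bold>\<and> is_out y) \<^bold>\<or> (\<^bold>\<not> cA y x)))) \<and>
     ((S \<Turnstile> present x \<^bold>\<and> (\<^bold>\<not> is_in x) \<^bold>\<and> is_out x) \<longleftrightarrow>
      (\<exists>y\<in>A. S \<Turnstile> present x \<^bold>\<and> present y \<^bold>\<and> cA y x \<^bold>\<and> is_in y \<^bold>\<and> (\<^bold>\<not> is_out y))))"

definition present_args :: "'a set \<Rightarrow> 'a literal set \<Rightarrow> 'a set" where
  "present_args A S = {x \<in> A. S \<Turnstile> present x}"

definition present_attacks :: "'a set \<Rightarrow> 'a literal set \<Rightarrow> ('a \<times> 'a) set" where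
  "present_attacks A S = {(y, x). x \<in> A \<and> y \<in> A \<and> (S \<Turnstile> present x \<^bold>\<and> present y \<^bold>\<and> cA y x)}"

text \<open>The combination of \<open>is_in x\<close> and \<open>is_out x\<close> gets no label, so totality of the labelling on the
  present arguments is a genuine claim about the state.\<close>

definition assoc_labelling :: "'a set \<Rightarrow> 'a literal set \<Rightarrow> ('a \<rightharpoonup> label)" where
  "assoc_labelling A S = (\<lambda>x.
     if x \<notin> present_args A S then None
     else if S \<Turnstile> is_in x \<^bold>\<and> (\<^bold>\<not> is_out x) then Some IN
     else if S \<Turnstile> (\<^bold>\<not> is_in x) \<^bold>\<and> is_out x then Some OUT
     else if S \<Turnstile> (\<^bold>\<not> is_in x) \<^bold>\<and> (\<^bold>\<not> is_out x) then Some UNDEC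
     else None)"

end

theory Submission imports Defs begin

text \<open>The conditions defining a \<open>\<Sigma>\<^sub>c\<close>-argumentative state range over all attackers in
  \<open>A\<close>, those of a complete labelling only over the present ones, so two invariants of valid paths
  are needed: absent arguments are out, and no argument is both in and out. The second one rests on
  the priorities. Under the invariants, if \<open>I2 x\<close> is triggered while \<open>x\<close> is out then
  so is \<open>I1 x\<close>, which overrides it; if \<open>Delta2 y x\<close> is triggered while \<open>x\<close> is in
  then so is \<open>Delta1 y x\<close>, which overrides it; and \<open>I2 x\<close> and \<open>Delta2 y x\<close> are
  never triggered together.\<close>

definition status_consistent :: "'a set \<Rightarrow> 'a literal set \<Rightarrow> bool" where
  "status_consistent A S \<longleftrightarrow> (\<forall>x\<in>A.
     \<not> (Pos (In x) \<in> S \<and> Pos (Out x) \<in> S) \<and> (Pos (Present x) \<notin> S \<longrightarrow> Pos (Out x) \<in> S))"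

lemma status_consistent_init: "status_consistent A (arg_init A R)"
  unfolding status_consistent_def arg_init_def by auto

text \<open>\<open>Pos (In x)\<close> is an effect of \<open>Enunciate x\<close> and
  \<open>I2 x\<close> only, \<open>Pos (Out x)\<close> of \<open>Delta2 y x\<close> only. A clash
  after the step would thus pair one of these events with a persisting status or with another of
  them.\<close>

lemma status_consistent_successor:
  assumes path: "valid_path (arg_context A R N) S E" and t: "t \<le> N"
    and inv: "status_consistent A (S t)"
  shows "status_consistent A (S (Suc t))"
proof -
  have events: "E t \<subseteq> arg_actions A \<union> arg_exogenous A"
    and pre: "\<And>e. e \<in> E t \<Longrightarrow> S t \<Turnstile> arg_pre A e"
    and prio: "\<And>e e'. e \<in> E t \<Longrightarrow> e' \<in> E t \<Longrightarrow> (e, e') \<notin> arg_priority A"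
    and forced: "\<And>e. e \<in> arg_exogenous A \<Longrightarrow> S t \<Turnstile> arg_tri A e \<Longrightarrow>
      e \<in> E t \<or> (\<exists>e' \<in> E t. (e', e) \<in> arg_priority A)"
    and quiet: "\<And>e. E t \<inter> arg_actions A \<noteq> {} \<Longrightarrow> e \<in> arg_exogenous A \<Longrightarrow> \<not> (S t \<Turnstile> arg_tri A e)"
    and succ: "S (Suc t) = successor (arg_context A R N) (S t) (E t)"
    using path t unfolding valid_path_def arg_context_def by auto
  have excl: "\<not> (Pos (In y) \<in> S t \<and> Pos (Out y) \<in> S t)"
    and absent: "Pos (Present y) \<notin> S t \<Longrightarrow> Pos (Out y) \<in> S t" if "y \<in> A" for y
    using inv that unfolding status_consistent_def by auto
  have pos_succ: "Pos f \<in> S (Suc t) \<longleftrightarrow>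
      (Pos f \<in> S t \<and> (\<forall>e\<in>E t. Neg f \<notin> arg_eff e)) \<or> (\<exists>e\<in>E t. Pos f \<in> arg_eff e)"
    if "f \<in> fluents A" for f
    using that unfolding succ successor_def arg_context_def literals_def by auto
  \<comment> \<open>Nothing overrides these events, so by \<open>forced\<close> they occur whenever
    they are triggered.\<close>
  have Delta1_maximal: "(e, Delta1 y x) \<notin> arg_priority A"
    and I1_maximal: "(e, I1 x) \<notin> arg_priority A" for e x y
    unfolding arg_priority_def by auto
  \<comment> \<open>The precondition of an exogenous event is its trigger, so its occurrence already
    blocks every action.\<close>
  have no_action: "Enunciate z \<notin> E t" if "e \<in> E t" "e \<in> arg_exogenous A" for e z
  proof
    assume "Enunciate z \<in> E t"
    then have "Enunciate z \<in> E t \<inter> arg_actions A"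
      using events by (auto simp: arg_actions_def arg_exogenous_def)
    moreover have "S t \<Turnstile> arg_tri A e"
      using pre[OF that(1)] that(2) by (auto simp: arg_pre_def arg_exogenous_def)
    ultimately show False using quiet that(2) by blast
  qed
  have I2: "Pos (Out x) \<notin> S t \<and> (\<forall>y. Delta2 y x \<notin> E t)"
    if mem: "I2 x \<in> E t" for x
  proof -
    have x: "x \<in> A" using events mem by (auto simp: arg_actions_def arg_exogenous_def)
    have tri: "Pos (Present x) \<in> S t"
      "\<And>y. y \<in> A \<Longrightarrow> Pos (Can_Attack y x) \<in> S t \<Longrightarrow> Pos (Out y) \<in> S t"
      using pre[OF mem] by (auto simp: arg_pre_def)
    have "Pos (Out x) \<notin> S t"
    proof
      assume "Pos (Out x) \<in> S t"
      \<comment> \<open>The trigger of \<open>I2 x\<close> makes every attacker of \<open>x\<close>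
        out, hence by \<open>excl\<close> not in, as \<open>I1 x\<close> requires.\<close>
      then have "S t \<Turnstile> arg_tri A (I1 x)" using tri excl by auto
      then have "I1 x \<in> E t"
        using forced[of "I1 x"] x I1_maximal by (auto simp: arg_exogenous_def)
      moreover have "(I1 x, I2 x) \<in> arg_priority A" using x by (auto simp: arg_priority_def)
      ultimately show False using prio mem by blast
    qed
    moreover have "Delta2 y x \<notin> E t" for y
    proof
      assume d: "Delta2 y x \<in> E t"
      then have "y \<in> A" using events by (auto simp: arg_actions_def arg_exogenous_def)
      then show False using pre[OF d] tri(2)[of y] excl[of y] by (auto simp: arg_pre_def)
    qed
    ultimately show ?thesis by blast
  qed
  have Delta2: "Pos (In x) \<notin> S t" if mem: "Delta2 y x \<in> E t" for x y
  proof
    assume "Pos (In x) \<in> S t"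
    have xy: "x \<in> A" "y \<in> A" using events mem by (auto simp: arg_actions_def arg_exogenous_def)
    \<comment> \<open>The attacker \<open>y\<close> is in, so \<open>excl\<close> gives the missing
      conjunct that \<open>y\<close> is not out.\<close>
    have "S t \<Turnstile> arg_tri A (Delta1 y x)"
      using pre[OF mem] excl[OF xy(2)] \<open>Pos (In x) \<in> S t\<close> by (auto simp: arg_pre_def)
    then have "Delta1 y x \<in> E t"
      using forced[of "Delta1 y x"] xy Delta1_maximal by (auto simp: arg_exogenous_def)
    moreover have "(Delta1 y x, Delta2 y x) \<in> arg_priority A"
      using xy by (auto simp: arg_priority_def)
    ultimately show False using prio mem by blast
  qed
  have no_Delta2: "Delta2 y x \<notin> E t" if "Enunciate z \<in> E t" for x y z
    using no_action[of "Delta2 y x" z] that events by (auto simp: arg_actions_def)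
  show ?thesis
    unfolding status_consistent_def
  proof (intro ballI conjI impI)
    fix x assume x: "x \<in> A"
    have flu: "Present x \<in> fluents A" "In x \<in> fluents A" "Out x \<in> fluents A"
      using x by (auto simp: fluents_def)
    have in_cases: "Pos (In x) \<in> S t \<or> Enunciate x \<in> E t \<or> I2 x \<in> E t" if "Pos (In x) \<in> S (Suc t)"
    proof -
      have "Pos (In x) \<in> arg_eff e \<Longrightarrow> e = Enunciate x \<or> e = I2 x" for e by (cases e) auto
      then show ?thesis using that pos_succ[OF flu(2)] by blast
    qed
    \<comment> \<open>An enunciation of \<open>x\<close> has \<open>Neg (Out x)\<close> as an
      effect, so \<open>Out x\<close> cannot merely persist through it.\<close>
    have out_cases: "Pos (Out x) \<in> S t \<and> Enunciate x \<notin> E t \<or> (\<exists>y. Delta2 y x \<in> E t)"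
      if "Pos (Out x) \<in> S (Suc t)"
    proof -
      have "Pos (Out x) \<in> arg_eff e \<Longrightarrow> \<exists>y. e = Delta2 y x" for e by (cases e) auto
      moreover have "Neg (Out x) \<in> arg_eff (Enunciate x)" by simp
      ultimately show ?thesis using that pos_succ[OF flu(3)] by blast
    qed
    show "\<not> (Pos (In x) \<in> S (Suc t) \<and> Pos (Out x) \<in> S (Suc t))"
      using in_cases out_cases excl[OF x] I2 Delta2 no_Delta2 by blast
    assume np: "Pos (Present x) \<notin> S (Suc t)"
    \<comment> \<open>Presence is never revoked, so \<open>x\<close> was absent and hence out before
      the step. Only \<open>Enunciate x\<close> and \<open>I1 x\<close> could end that: the first
      would make \<open>x\<close> present, the second requires \<open>x\<close> to be
      present.\<close>
    have "Neg (Present x) \<notin> arg_eff e" for e by (cases e) auto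
    then have np_t: "Pos (Present x) \<notin> S t" using np pos_succ[OF flu(1)] by blast
    have "Enunciate x \<notin> E t" using np pos_succ[OF flu(1)] by force
    moreover have "I1 x \<notin> E t" using pre[of "I1 x"] np_t by (auto simp: arg_pre_def)
    moreover have "Neg (Out x) \<in> arg_eff e \<Longrightarrow> e = Enunciate x \<or> e = I1 x" for e
      by (cases e) auto
    ultimately show "Pos (Out x) \<in> S (Suc t)"
      using absent[OF x np_t] pos_succ[OF flu(3)] by blast
  qed
qed

text \<open>The bound \<open>N + 1\<close> includes the final state, which the step at time
  \<open>N\<close> produces.\<close>

lemma status_consistent_valid_path:
  assumes "valid_path (arg_context A R N) S E" "t \<le> N + 1"
  shows "status_consistent A (S t)"
  using assms(2)
proof (induction t)
  case 0
  have "S 0 = arg_init A R" using assms(1) by (simp add: valid_path_def arg_context_def)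
  then show ?case by (simp add: status_consistent_init)
next
  case (Suc t)
  then show ?case using status_consistent_successor[OF assms(1)] by simp
qed

lemma complete_labelling_assoc_labelling:
  assumes inv: "status_consistent A S" and arg: "sigma_c_argumentative A S"
  shows "complete_labelling (present_args A S) (present_attacks A S) (assoc_labelling A S)"
proof -
  let ?L = "assoc_labelling A S"
  \<comment> \<open>Since in and out exclude each other, a single fluent decides each of these two
    labels.\<close>
  have L_IN: "?L x = Some IN \<longleftrightarrow> Pos (In x) \<in> S"
    and L_OUT: "?L x = Some OUT \<longleftrightarrow> Pos (Out x) \<in> S"
    and excl: "\<not> (Pos (In x) \<in> S \<and> Pos (Out x) \<in> S)" if "x \<in> present_args A S" for x
    using inv that by (auto simp: assoc_labelling_def status_consistent_def present_args_def)
  have absent: "Pos (Out y) \<in> S \<and> Pos (In y) \<notin> S" if "y \<in> A" "Pos (Present y) \<notin> S" for y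
    using inv that by (auto simp: status_consistent_def)
  \<comment> \<open>Totality holds because \<open>excl\<close> rules out the only combination of
    statuses without a label.\<close>
  have "dom ?L = present_args A S"
    using excl by (auto simp: assoc_labelling_def split: if_splits)
  moreover have "(?L x = Some IN \<longleftrightarrow> (\<forall>y. (y, x) \<in> present_attacks A S \<longrightarrow> ?L y = Some OUT)) \<and>
      (?L x = Some OUT \<longleftrightarrow> (\<exists>y. (y, x) \<in> present_attacks A S \<and> ?L y = Some IN))"
    if x: "x \<in> present_args A S" for x
  proof -
    have xA: "x \<in> A" and xp: "Pos (Present x) \<in> S" using x by (auto simp: present_args_def)
    have attack: "(y, x) \<in> present_attacks A S \<longleftrightarrow>
        y \<in> present_args A S \<and> Pos (Can_Attack y x) \<in> S" for y
      using xA xp by (auto simp: present_attacks_def present_args_def)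
    have "Pos (In x) \<in> S \<longleftrightarrow>
        (\<forall>y\<in>A. Pos (Can_Attack y x) \<in> S \<longrightarrow> Pos (In y) \<notin> S \<and> Pos (Out y) \<in> S)"
      using arg xA xp excl[OF x] by (auto simp: sigma_c_argumentative_def)
    \<comment> \<open>An absent attacker is out and not in, so it meets the condition automatically
      and the quantifier over \<open>A\<close> shrinks to present attackers.\<close>
    also have "\<dots> \<longleftrightarrow> (\<forall>y. (y, x) \<in> present_attacks A S \<longrightarrow> ?L y = Some OUT)"
      using absent attack L_OUT excl unfolding present_args_def sat.simps by blast
    finally have "?L x = Some IN \<longleftrightarrow> \<dots>" by (simp add: L_IN[OF x])
    \<comment> \<open>Here the presence of the attacker is already part of the condition on
      argumentative states.\<close>
    moreover have "Pos (Out x) \<in> S \<longleftrightarrow> (\<exists>y\<in>A. Pos (Present y) \<in> S \<and>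
        Pos (Can_Attack y x) \<in> S \<and> Pos (In y) \<in> S \<and> Pos (Out y) \<notin> S)"
      using arg xA xp excl[OF x] by (auto simp: sigma_c_argumentative_def)
    then have "?L x = Some OUT \<longleftrightarrow> (\<exists>y. (y, x) \<in> present_attacks A S \<and> ?L y = Some IN)"
      using attack L_IN excl L_OUT[OF x] by (auto simp: present_args_def)
    ultimately show ?thesis by blast
  qed
  ultimately show ?thesis by (simp add: complete_labelling_def labelling_def)
qed

theorem theorem2:
  fixes A :: "'a set" and R :: "('a \<times> 'a) set" and N :: nat
    and \<kappa> :: "'a ctxt" and \<sigma> :: "('a event \<times> nat) set"
    and S :: "nat \<Rightarrow> 'a literal set" and E :: "nat \<Rightarrow> 'a event set" and t :: nat
  assumes "arg_framework A R"
    and "\<kappa> = arg_context A R N"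
    and "is_sequence \<kappa> \<sigma>"
    and "seq_valid_path (\<sigma>, \<kappa>) S E"
    and "t \<le> N + 1"
    and "sigma_c_argumentative A (S t)"
  shows "arg_framework (present_args A (S t)) (present_attacks A (S t)) \<and>
    complete_labelling (present_args A (S t)) (present_attacks A (S t)) (assoc_labelling A (S t))"
proof
  show "arg_framework (present_args A (S t)) (present_attacks A (S t))"
    using assms(1) by (auto simp: arg_framework_def present_args_def present_attacks_def)
  have "valid_path (arg_context A R N) S E"
    using assms(2,4) by (simp add: seq_valid_path_def)
  then show "complete_labelling (present_args A (S t)) (present_attacks A (S t))
      (assoc_labelling A (S t))"
    using assms(5,6) by (intro complete_labelling_assoc_labelling status_consistent_valid_path)
qed

end
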